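(* Let $n\ge 2$. Given any $C^2$ function $\varphi:(0,\infty)\to\mathbb{R}$ satisfying $$\lim_{s\to\infty}\varphi(s)=\infty,\qquad \lim_{s\to\infty}\varphi'(s)=0,\qquad \lim_{s\to\infty}\varphi''(s)=0,$$ there is a function $u:\mathbb{R}^n\to\mathbb{R}$, depending on $\varphi$, with compact support, such that $u$ is twice differentiable everywhere in $\mathbb{R}^n$, its Laplacian $\Delta u$ is continuous on $\mathbb{R}^n$, and its Hessian $D^2u$ is unbounded. In particular, $u\notin C^2(\mathbb{R}^n)$.
   Context: Twice differentiable at a point means that $u$ is differentiable in a neighbourhood of the point and each first partial derivative $\partial u/\partial x_j$ is (Fréchet) differentiable at that point. $\Delta u=\sum_{j=1}^n \partial^2u/\partial x_j^2$ is the pointwise Laplacian. The Hessian is unbounded if at least one second partial derivative is an unbounded function. *)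

theory Defs
  imports "HOL-Analysis.Analysis"
begin

text \<open>The vector \<open>axis j 1\<close> is the \<open>j\<close>-th standard basis vector, so this is the usual partial
  derivative, as a derivative in one real variable. Its value is unspecified where that derivative
  does not exist.\<close>

definition partial_deriv :: "'n::finite \<Rightarrow> (real ^ 'n \<Rightarrow> real) \<Rightarrow> real ^ 'n \<Rightarrow> real" where
  "partial_deriv j u x = deriv (\<lambda>t. u (x + t *\<^sub>R axis j 1)) 0"

definition has_partial_deriv_at :: "'n::finite \<Rightarrow> (real ^ 'n \<Rightarrow> real) \<Rightarrow> real ^ 'n \<Rightarrow> bool" where
  "has_partial_deriv_at j u x \<longleftrightarrow> (\<lambda>t. u (x + t *\<^sub>R axis j 1)) differentiable (at 0)"

definition twice_differentiable_at :: "(real ^ 'n::finite \<Rightarrow> real) \<Rightarrow> real ^ 'n \<Rightarrow> bool" where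
  "twice_differentiable_at u x \<longleftrightarrow>
     (\<forall>\<^sub>F y in nhds x. u differentiable (at y)) \<and>
     (\<forall>j. partial_deriv j u differentiable (at x))"

definition laplacian :: "(real ^ 'n::finite \<Rightarrow> real) \<Rightarrow> real ^ 'n \<Rightarrow> real" where
  "laplacian u x = (\<Sum>j\<in>UNIV. partial_deriv j (partial_deriv j u) x)"

definition hessian :: "(real ^ 'n::finite \<Rightarrow> real) \<Rightarrow> real ^ 'n \<Rightarrow> real ^ 'n ^ 'n" where
  "hessian u x = (\<chi> i j. partial_deriv i (partial_deriv j u) x)"

definition unbounded_hessian :: "(real ^ 'n::finite \<Rightarrow> real) \<Rightarrow> bool" where
  "unbounded_hessian u \<longleftrightarrow> (\<exists>i j. \<not> bounded (range (\<lambda>x. hessian u x $ i $ j)))"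

text \<open>Membership in \<open>C\<^sup>k(\<real>\<^sup>n)\<close> for \<open>k = 1, 2\<close>: all partial derivatives up to order \<open>k\<close> exist
  everywhere and are continuous. Continuity of the function itself follows and is included only
  to match the usual wording.\<close>

definition C1_euclidean :: "(real ^ 'n::finite \<Rightarrow> real) \<Rightarrow> bool" where
  "C1_euclidean u \<longleftrightarrow> continuous_on UNIV u \<and>
     (\<forall>j. (\<forall>x. has_partial_deriv_at j u x) \<and> continuous_on UNIV (partial_deriv j u))"

definition C2_euclidean :: "(real ^ 'n::finite \<Rightarrow> real) \<Rightarrow> bool" where
  "C2_euclidean u \<longleftrightarrow> C1_euclidean u \<and> (\<forall>j. C1_euclidean (partial_deriv j u))"

text \<open>Only the values of the function on the open half-line matter here, since \<open>deriv\<close> is local.\<close>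

definition C2_pos :: "(real \<Rightarrow> real) \<Rightarrow> bool" where
  "C2_pos \<phi> \<longleftrightarrow> \<phi> C1_differentiable_on {0<..} \<and> deriv \<phi> C1_differentiable_on {0<..}"

definition compact_support :: "(real ^ 'n::finite \<Rightarrow> real) \<Rightarrow> bool" where
  "compact_support u \<longleftrightarrow> compact (closure {x. u x \<noteq> 0})"

end

theory Submission
  imports Defs
begin

text \<open>Multiplying \<open>z\<^sub>i z\<^sub>j\<close> by a slowly varying radial factor \<open>F(|z|\<^sup>2)\<close> gives a function whose
  mixed derivative at \<open>z = 0\<close> is \<open>F(0)\<close>. Since \<open>z\<^sub>i z\<^sub>j\<close> is harmonic, its Laplacian is controlled by
  \<open>s F'(s)\<close> and \<open>s\<^sup>2 F''(s)\<close>, where \<open>s = |z|\<^sup>2\<close>. For \<open>F\<close> equal to \<open>a\<close> times a cut-off of the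
  logarithm, these are \<open>O(a)\<close> even when \<open>F(0)\<close> is of size \<open>1 / a\<close>. Such bumps, centred at distance \<open>a = 2\<^sup>-\<^sup>k\<close> from the origin and
  with supports in disjoint annuli, add up to a function \<open>u\<close> whose mixed derivative is unbounded,
  while \<open>u\<close> and its gradient are \<open>O(|x|\<^sup>2)\<close> and its Laplacian is \<open>O(|x|)\<close>; this gives twice
  differentiability and continuity of the Laplacian at the origin as well.\<close>

section \<open>Partial derivatives and their dependence on local values only\<close>

lemma partial_deriv_eq:
  fixes u :: "real ^ 'n::finite \<Rightarrow> real"
  assumes "(u has_derivative u') (at x)"
  shows "partial_deriv j u x = u' (axis j 1)"
proof -
  have lin: "linear u'"
    using assms by (rule has_derivative_linear)
  have "((\<lambda>t. u (x + t *\<^sub>R axis j 1)) has_derivative (\<lambda>t. u' (t *\<^sub>R axis j 1))) (at 0)"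
    by (rule has_derivative_compose[where g = u])
      (auto intro!: derivative_eq_intros assms)
  moreover have "(\<lambda>t. u' (t *\<^sub>R axis j 1)) = (\<lambda>t. u' (axis j 1) * t)"
    using lin by (auto simp: linear_cmul mult.commute)
  ultimately show ?thesis
    unfolding partial_deriv_def by (intro DERIV_imp_deriv) (simp add: has_field_derivative_def)
qed

lemma axis_one_nth: "(axis l 1 :: real ^ 'n) $ k = of_bool (k = l)"
  by (simp add: axis_def)

lemma inner_axis_one: "x \<bullet> axis l 1 = (x :: real ^ 'n) $ l"
  by (simp add: inner_axis)

lemma partial_deriv_cong_ev:
  fixes u w :: "real ^ 'n::finite \<Rightarrow> real"
  assumes "\<forall>\<^sub>F y in nhds x. u y = w y"
  shows "partial_deriv j u x = partial_deriv j w x"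
proof -
  have "((\<lambda>t. x + t *\<^sub>R axis j 1) \<longlongrightarrow> x + 0 *\<^sub>R axis j 1) (nhds (0::real))"
    by (intro tendsto_intros) (simp add: filterlim_ident)
  then have "\<forall>\<^sub>F t in nhds 0. u (x + t *\<^sub>R axis j 1) = w (x + t *\<^sub>R axis j 1)"
    using assms by (fastforce simp: filterlim_iff)
  then show ?thesis
    unfolding partial_deriv_def by (intro deriv_cong_ev) auto
qed

text \<open>Equality near \<open>x\<close> is also equality near every point close to
  \<open>x\<close>. Stating the conclusion on a neighbourhood is what allows a second partial
  derivative to be taken.\<close>

lemma eventually_partial_deriv_cong:
  fixes u w :: "real ^ 'n::finite \<Rightarrow> real"
  assumes "\<forall>\<^sub>F y in nhds x. u y = w y"
  shows "\<forall>\<^sub>F y in nhds x. partial_deriv j u y = partial_deriv j w y"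
proof -
  have "\<forall>\<^sub>F y in nhds x. \<forall>\<^sub>F z in nhds y. u z = w z"
    using assms by (simp add: eventually_eventually)
  then show ?thesis
    by eventually_elim (rule partial_deriv_cong_ev)
qed

lemma second_partial_cong_ev:
  fixes u w :: "real ^ 'n::finite \<Rightarrow> real"
  assumes "\<forall>\<^sub>F y in nhds x. u y = w y"
  shows "partial_deriv i (partial_deriv j u) x = partial_deriv i (partial_deriv j w) x"
  by (intro partial_deriv_cong_ev eventually_partial_deriv_cong assms)

lemma laplacian_cong_ev:
  fixes u w :: "real ^ 'n::finite \<Rightarrow> real"
  assumes "\<forall>\<^sub>F y in nhds x. u y = w y"
  shows "laplacian u x = laplacian w x"
  unfolding laplacian_def by (intro sum.cong refl second_partial_cong_ev assms)

lemma differentiable_cong_ev: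
  fixes u w :: "'a::real_normed_vector \<Rightarrow> 'b::real_normed_vector"
  assumes "\<forall>\<^sub>F y in nhds x. u y = w y" and "w differentiable (at x)"
  shows "u differentiable (at x)"
proof -
  have eq: "\<forall>\<^sub>F y in nhds x. w y = u y"
    using assms(1) by eventually_elim simp
  obtain D where "(w has_derivative D) (at x)"
    using assms(2) by (auto simp: differentiable_def)
  then have "(u has_derivative D) (at x)"
    by (rule has_derivative_transform_eventually)
      (use eq eventually_nhds_x_imp_x[OF eq] in \<open>auto simp: eventually_at_filter elim: eventually_mono\<close>)
  then show ?thesis
    by (auto simp: differentiable_def)
qed

lemma twice_differentiable_at_cong_ev:
  fixes u w :: "real ^ 'n::finite \<Rightarrow> real"
  assumes eq: "\<forall>\<^sub>F y in nhds x. u y = w y" and w: "twice_differentiable_at w x"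
  shows "twice_differentiable_at u x"
  unfolding twice_differentiable_at_def
proof (intro conjI allI)
  have "\<forall>\<^sub>F y in nhds x. \<forall>\<^sub>F z in nhds y. u z = w z"
    using eq by (simp add: eventually_eventually)
  moreover have "\<forall>\<^sub>F y in nhds x. w differentiable (at y)"
    using w by (simp add: twice_differentiable_at_def)
  ultimately show "\<forall>\<^sub>F y in nhds x. u differentiable (at y)"
    by eventually_elim (rule differentiable_cong_ev)
  show "partial_deriv j u differentiable (at x)" for j
    using w eventually_partial_deriv_cong[OF eq]
    by (auto simp: twice_differentiable_at_def intro: differentiable_cong_ev)
qed

section \<open>Twice differentiability at the origin from quadratic bounds\<close>

lemma has_derivative_zero_quadratic:
  fixes f :: "'a::real_normed_vector \<Rightarrow> real"
  assumes "\<And>x. \<bar>f x\<bar> \<le> C * (norm x)\<^sup>2"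
  shows "(f has_derivative (\<lambda>_. 0)) (at 0)"
proof -
  have f0: "f 0 = 0"
    using assms[of 0] by simp
  have "((\<lambda>x. f x / norm x) \<longlongrightarrow> 0) (at 0)"
  proof (rule Lim_null_comparison)
    show "\<forall>\<^sub>F x in at 0. norm (f x / norm x) \<le> C * norm x"
      using assms by (auto simp: eventually_at_filter power2_eq_square field_simps)
    show "((\<lambda>x. C * norm x) \<longlongrightarrow> 0) (at (0::'a))"
      by (auto intro!: tendsto_eq_intros)
  qed
  then have "((\<lambda>x. norm (f x) / norm x) \<longlongrightarrow> 0) (at 0)"
    using tendsto_rabs_zero by fastforce
  then show ?thesis
    by (simp add: has_derivative_at f0 )
qed

text \<open>A function of size O(|x|^2) has derivative 0 at the origin; this is applied first to
  \<open>u\<close>, then to each of its first partials. It serves the one point at which the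
  supports of the bumps accumulate and no single bump represents the sum nearby.\<close>

lemma twice_differentiable_at_zero:
  fixes u :: "real ^ 'n::finite \<Rightarrow> real"
  assumes u: "\<And>x. \<bar>u x\<bar> \<le> C * (norm x)\<^sup>2"
    and Du: "\<And>j x. x \<noteq> 0 \<Longrightarrow> \<bar>partial_deriv j u x\<bar> \<le> C * (norm x)\<^sup>2"
    and away: "\<And>x. x \<noteq> 0 \<Longrightarrow> twice_differentiable_at u x"
  shows "twice_differentiable_at u 0" and "laplacian u 0 = 0"
proof -
  have u': "(u has_derivative (\<lambda>_. 0)) (at 0)"
    by (rule has_derivative_zero_quadratic[OF u])
  \<comment> \<open>At \<open>x = 0\<close> the bound demands that the partial derivative vanish,
    which follows from the derivative of \<open>u\<close> there being 0.\<close>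
  have "\<bar>partial_deriv j u x\<bar> \<le> C * (norm x)\<^sup>2" for j x
    using Du[of x j] partial_deriv_eq[OF u', of j] by (cases "x = 0") auto
  then have Du': "(partial_deriv j u has_derivative (\<lambda>_. 0)) (at 0)" for j
    by (rule has_derivative_zero_quadratic)
  have "u differentiable (at y)" for y
    using u' away[of y]
    by (cases "y = 0") (auto simp: twice_differentiable_at_def differentiable_def
        dest: eventually_nhds_x_imp_x)
  then show "twice_differentiable_at u 0"
    using Du' by (auto simp: twice_differentiable_at_def differentiable_def)
  show "laplacian u 0 = 0"
    by (simp add: laplacian_def partial_deriv_eq[OF Du'])
qed

text \<open>A continuous second partial is bounded on the compact support, and it is 0 off the
  support because \<open>u\<close> vanishes near each such point.\<close>

lemma hessian_unbounded_imp_not_C2: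
  fixes u :: "real ^ 'n::finite \<Rightarrow> real"
  assumes supp: "compact_support u" and unb: "unbounded_hessian u"
  shows "\<not> C2_euclidean u"
proof
  assume C2: "C2_euclidean u"
  define K where "K = closure {x. u x \<noteq> 0}"
  obtain i j where ij: "\<not> bounded (range (\<lambda>x. hessian u x $ i $ j))"
    using unb by (auto simp: unbounded_hessian_def)
  let ?H = "partial_deriv i (partial_deriv j u)"
  have "continuous_on UNIV ?H"
    using C2 by (simp add: C2_euclidean_def C1_euclidean_def)
  moreover have "compact K"
    using supp by (simp add: compact_support_def K_def)
  ultimately have "bounded (?H ` K)"
    by (meson compact_continuous_image compact_imp_bounded continuous_on_subset subset_UNIV)
  moreover have "?H x = 0" if "x \<notin> K" for x
  proof -
    have "open (- K)"
      by (simp add: K_def open_Compl)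
    then have "\<forall>\<^sub>F y in nhds x. y \<in> - K"
      using that by (intro eventually_nhds_in_open) auto
    then have "\<forall>\<^sub>F y in nhds x. u y = 0"
      by eventually_elim (use closure_subset[of "{x. u x \<noteq> 0}"] in \<open>auto simp: K_def\<close>)
    then have "?H x = partial_deriv i (partial_deriv j (\<lambda>_. 0)) x"
      by (rule second_partial_cong_ev)
    then show ?thesis
      by (simp add: partial_deriv_def)
  qed
  then have "range ?H \<subseteq> insert 0 (?H ` K)"
    by auto
  ultimately have "bounded (range ?H)"
    by (meson bounded_insert bounded_subset)
  then show False
    using ij by (simp add: hessian_def)
qed

section \<open>One bump: a harmonic quadratic times a radial factor\<close>

definition bump :: "'n::finite \<Rightarrow> 'n \<Rightarrow> real ^ 'n \<Rightarrow> (real \<Rightarrow> real) \<Rightarrow> real ^ 'n \<Rightarrow> real" where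
  "bump i j p F x = (x - p) $ i * (x - p) $ j * F ((x - p) \<bullet> (x - p))"

text \<open>The derivatives are two-sided even at \<open>s = 0\<close>, the value of |x - p|^2 at
  the centre, so that the chain rule applies at \<open>x = p\<close> too.\<close>

locale radial_profile =
  fixes i j :: "'n::finite" and p :: "real ^ 'n" and F F1 F2 :: "real \<Rightarrow> real"
  assumes F: "\<And>s. s \<ge> 0 \<Longrightarrow> (F has_real_derivative F1 s) (at s)"
    and F1: "\<And>s. s \<ge> 0 \<Longrightarrow> (F1 has_real_derivative F2 s) (at s)"
    and F2: "continuous_on {0..} F2"
    and ij: "i \<noteq> j"
begin

lemma coord_has_derivative: "((\<lambda>x. (x - p) $ k) has_derivative (\<lambda>v. v $ k)) (at x)"
  by (rule bounded_linear.has_derivative[OF bounded_linear_vec_nth])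
    (auto intro!: derivative_eq_intros)

lemma radial_has_derivative:
  assumes "\<And>s. s \<ge> 0 \<Longrightarrow> (G has_real_derivative G' s) (at s)"
  shows "((\<lambda>x. G ((x - p) \<bullet> (x - p))) has_derivative
           (\<lambda>v. 2 * ((x - p) \<bullet> v) * G' ((x - p) \<bullet> (x - p)))) (at x)"
proof -
  have "((\<lambda>x. (x - p) \<bullet> (x - p)) has_derivative (\<lambda>v. 2 * ((x - p) \<bullet> v))) (at x)"
    by (auto intro!: derivative_eq_intros simp: inner_commute)
  then show ?thesis
    by (rule DERIV_compose_FDERIV[where f = G and g = "\<lambda>x. (x - p) \<bullet> (x - p)", OF assms, rotated]) simp
qed

lemma bump_has_derivative:
  "(bump i j p F has_derivative (\<lambda>v. v $ i * (x - p) $ j * F ((x - p) \<bullet> (x - p))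
     + (x - p) $ i * v $ j * F ((x - p) \<bullet> (x - p))
     + 2 * (x - p) $ i * (x - p) $ j * F1 ((x - p) \<bullet> (x - p)) * ((x - p) \<bullet> v))) (at x)"
  unfolding bump_def
  by (rule has_derivative_eq_rhs[OF has_derivative_mult[OF has_derivative_mult
        [OF coord_has_derivative coord_has_derivative] radial_has_derivative[OF F]]])
    (simp_all add: fun_eq_iff ring_distribs mult_ac add_ac del: vector_minus_component)

lemma partial_deriv_bump:
  "partial_deriv l (bump i j p F) = (\<lambda>x. of_bool (l = i) * (x - p) $ j * F ((x - p) \<bullet> (x - p))
     + of_bool (l = j) * (x - p) $ i * F ((x - p) \<bullet> (x - p))
     + 2 * (x - p) $ i * (x - p) $ j * (x - p) $ l * F1 ((x - p) \<bullet> (x - p)))"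
  by (rule ext, subst partial_deriv_eq[OF bump_has_derivative])
    (auto simp: axis_one_nth inner_axis_one)

lemma partial_deriv_bump_has_derivative:
  "(partial_deriv l (bump i j p F) has_derivative
     (\<lambda>v. of_bool (l = i) * (v $ j * F ((x - p) \<bullet> (x - p))
            + 2 * (x - p) $ j * F1 ((x - p) \<bullet> (x - p)) * ((x - p) \<bullet> v))
     + of_bool (l = j) * (v $ i * F ((x - p) \<bullet> (x - p))
            + 2 * (x - p) $ i * F1 ((x - p) \<bullet> (x - p)) * ((x - p) \<bullet> v))
     + 2 * (v $ i * (x - p) $ j * (x - p) $ l + (x - p) $ i * v $ j * (x - p) $ l
            + (x - p) $ i * (x - p) $ j * v $ l) * F1 ((x - p) \<bullet> (x - p))
     + 4 * (x - p) $ i * (x - p) $ j * (x - p) $ l * F2 ((x - p) \<bullet> (x - p)) * ((x - p) \<bullet> v))) (at x)"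
  unfolding partial_deriv_bump
  by (rule has_derivative_eq_rhs[OF has_derivative_add[OF has_derivative_add[OF
        has_derivative_mult[OF has_derivative_mult[OF has_derivative_const coord_has_derivative]
          radial_has_derivative[OF F]]
        has_derivative_mult[OF has_derivative_mult[OF has_derivative_const coord_has_derivative]
          radial_has_derivative[OF F]]]
        has_derivative_mult[OF has_derivative_mult[OF has_derivative_mult[OF has_derivative_mult
          [OF has_derivative_const coord_has_derivative] coord_has_derivative] coord_has_derivative]
          radial_has_derivative[OF F1]]]])
    (simp_all add: fun_eq_iff ring_distribs mult_ac add_ac del: vector_minus_component)

lemma twice_differentiable_at_bump: "twice_differentiable_at (bump i j p F) x"
  unfolding twice_differentiable_at_def differentiable_def
  using bump_has_derivative partial_deriv_bump_has_derivative by (intro conjI always_eventually allI exI)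

text \<open>At the centre every term of the derivative keeps a factor that is a coordinate of
  \<open>x - p\<close>, except \<open>v $ i * F\<close>, which survives in direction
  \<open>i\<close>.\<close>

lemma mixed_partial_bump_center: "partial_deriv i (partial_deriv j (bump i j p F)) p = F 0"
  using ij by (subst partial_deriv_eq[OF partial_deriv_bump_has_derivative]) (auto simp: axis_one_nth)

text \<open>With z = x - p, the term in \<open>F\<close> drops out since z_i z_j is harmonic. The
  radial factor has Laplacian 4 s F2 + 2 n F1, and the cross term contributes 8 F1, because z_i z_j
  is homogeneous of degree 2.\<close>

lemma laplacian_bump:
  "laplacian (bump i j p F) = (\<lambda>x. (x - p) $ i * (x - p) $ j *
     (4 * ((x - p) \<bullet> (x - p)) * F2 ((x - p) \<bullet> (x - p))
       + (2 * real CARD('n) + 8) * F1 ((x - p) \<bullet> (x - p))))"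
proof (rule ext)
  fix x
  define z where "z = x - p"
  define s where "s = z \<bullet> z"
  have s: "s = (\<Sum>l\<in>UNIV. z $ l * z $ l)"
    by (simp add: s_def inner_vec_def)
  have "partial_deriv l (partial_deriv l (bump i j p F)) x =
      of_bool (l = i) * (4 * z $ i * z $ j * F1 s) + of_bool (l = j) * (4 * z $ i * z $ j * F1 s)
      + 2 * z $ i * z $ j * F1 s + 4 * z $ i * z $ j * F2 s * (z $ l * z $ l)" for l
    using ij by (subst partial_deriv_eq[OF partial_deriv_bump_has_derivative])
      (auto simp: axis_one_nth inner_axis_one simp flip: z_def s_def)
  then have "laplacian (bump i j p F) x = (\<Sum>l\<in>UNIV. of_bool (l = i) * (4 * z $ i * z $ j * F1 s)
      + of_bool (l = j) * (4 * z $ i * z $ j * F1 s)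
      + 2 * z $ i * z $ j * F1 s + 4 * z $ i * z $ j * F2 s * (z $ l * z $ l))"
    by (simp add: laplacian_def)
  also have "\<dots> = 4 * z $ i * z $ j * F1 s + 4 * z $ i * z $ j * F1 s
      + real CARD('n) * (2 * z $ i * z $ j * F1 s) + 4 * z $ i * z $ j * F2 s * s"
    by (simp only: sum.distrib sum_distrib_left[symmetric] sum_distrib_right[symmetric] s[symmetric])
      simp
  finally show "laplacian (bump i j p F) x = (x - p) $ i * (x - p) $ j *
     (4 * ((x - p) \<bullet> (x - p)) * F2 ((x - p) \<bullet> (x - p))
       + (2 * real CARD('n) + 8) * F1 ((x - p) \<bullet> (x - p)))"
    by (simp add: algebra_simps flip: z_def s_def)
qed

lemma continuous_laplacian_bump: "continuous_on UNIV (laplacian (bump i j p F))"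
proof -
  have F1_cont: "continuous_on {0..} F1"
    using F1 by (intro continuous_at_imp_continuous_on) (auto intro: DERIV_isCont)
  show ?thesis
    unfolding laplacian_bump
    by (intro continuous_intros continuous_on_compose2[OF F2] continuous_on_compose2[OF F1_cont]) auto
qed

end


section \<open>The radial profile: a truncated, regularised logarithm\<close>

text \<open>Only the junction \<open>t = 0\<close> needs care: there the difference quotient of the
  truncation is dominated by that of \<open>g\<close>, which tends to
  \<open>g' 0 = 0\<close>.\<close>

lemma DERIV_compose_max_0:
  fixes g g' :: "real \<Rightarrow> real"
  assumes g: "\<And>t. (g has_real_derivative g' t) (at t)" and "g 0 = 0" "g' 0 = 0"
  shows "((\<lambda>t. g (max 0 t)) has_real_derivative g' (max 0 t)) (at t)"
proof (cases "t = 0")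
  case True
  have "((\<lambda>h. g h / h) \<longlongrightarrow> 0) (at 0)"
    using g[of 0] assms(2,3) by (simp add: has_field_derivative_def DERIV_def flip: has_field_derivative_def)
  then have "((\<lambda>h. g (max 0 h) / h) \<longlongrightarrow> 0) (at 0)"
  proof (rule Lim_null_comparison[rotated, OF tendsto_norm_zero], intro always_eventually allI)
    show "norm (g (max 0 h) / h) \<le> norm (g h / h)" for h
      by (cases "h \<ge> 0") (simp_all add: max_absorb1 max_absorb2 assms(2) del: norm_divide real_norm_def)
  qed
  then show ?thesis
    using True assms(2,3) by (simp add: DERIV_def)
next
  case False
  define w where "w = (if t > 0 then g else (\<lambda>_. 0))"
  have "(w has_real_derivative g' (max 0 t)) (at t)"
    using False g assms(3) by (auto simp: w_def)
  moreover have "\<forall>\<^sub>F s in nhds t. g (max 0 s) = w s"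
    using False assms(2) eventually_nhds_in_open[of "{0<..}" t] eventually_nhds_in_open[of "{..<0}" t]
    by (cases "t > 0") (auto simp: w_def elim!: eventually_mono)
  ultimately show ?thesis
    by (subst DERIV_cong_ev[OF refl _ refl]) auto
qed

text \<open>Since t - sin t vanishes to third order at 0, truncating it there gives a C^2 function.
  It stays within 1 of \<open>max 0 t\<close>, and its derivatives, built from 1 - cos and sin, are
  bounded.\<close>

definition cutoff :: "real \<Rightarrow> real" where
  "cutoff t = max 0 t - sin (max 0 t)"

lemma cutoff_DERIV: "(cutoff has_real_derivative 1 - cos (max 0 t)) (at t)"
  unfolding cutoff_def
  by (rule DERIV_compose_max_0[where g = "\<lambda>t. t - sin t"]) (auto intro!: derivative_eq_intros)

lemma cutoff_DERIV2: "((\<lambda>t. 1 - cos (max 0 t)) has_real_derivative sin (max 0 t)) (at t)"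
  by (rule DERIV_compose_max_0[where g = "\<lambda>t. 1 - cos t"]) (auto intro!: derivative_eq_intros)

lemma cutoff_bounds: "0 \<le> cutoff t" "max 0 t - 1 \<le> cutoff t" "cutoff t \<le> max 0 t + 1"
  using sin_x_le_x[of "max 0 t"] sin_le_one[of "max 0 t"] sin_ge_minus_one[of "max 0 t"]
  unfolding cutoff_def by linarith+

text \<open>With the shift, the argument of \<^const>\<open>cutoff\<close> at \<open>s = 0\<close> is exactly \<open>1 / a\<^sup>2\<close>, so
  \<open>profile a 0\<close> is of size \<open>1 / a\<close>; the power \<open>a ^ 8\<close> makes the support of the bump centred at
  distance \<open>a\<close> from the origin a ball of radius at most \<open>a / 8\<close>.\<close>

definition shift :: "real \<Rightarrow> real" where
  "shift a = a ^ 8 * exp (- 1 / a\<^sup>2)"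

text \<open>The logarithm is chosen because s times its first derivative and s^2 times its second
  are bounded. Adding \<open>shift a\<close> to \<open>s\<close> keeps it smooth at
  \<open>s = 0\<close>, and the truncation makes it vanish for \<open>s \<ge> a ^ 8\<close>.\<close>

definition profile :: "real \<Rightarrow> real \<Rightarrow> real" where
  "profile a s = a * cutoff (ln (a ^ 8) - ln (s + shift a))"

definition profile1 :: "real \<Rightarrow> real \<Rightarrow> real" where
  "profile1 a s = - a * (1 - cos (max 0 (ln (a ^ 8) - ln (s + shift a)))) / (s + shift a)"

definition profile2 :: "real \<Rightarrow> real \<Rightarrow> real" where
  "profile2 a s = a * (sin (max 0 (ln (a ^ 8) - ln (s + shift a)))
     + (1 - cos (max 0 (ln (a ^ 8) - ln (s + shift a))))) / (s + shift a)\<^sup>2"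

context
  fixes a :: real
  assumes a: "a > 0"
begin

lemma shift_pos: "shift a > 0"
  using a by (simp add: shift_def)

lemma ln_shift: "ln (shift a) = ln (a ^ 8) - 1 / a\<^sup>2"
  using a by (simp add: shift_def ln_mult)

lemma profile_DERIV:
  assumes "s \<ge> 0" shows "(profile a has_real_derivative profile1 a s) (at s)"
  unfolding profile_def [abs_def] profile1_def
  using shift_pos assms
  by (auto intro!: derivative_eq_intros DERIV_chain2[OF cutoff_DERIV] simp: divide_simps)

lemma profile1_DERIV:
  assumes "s \<ge> 0" shows "(profile1 a has_real_derivative profile2 a s) (at s)"
proof -
  define m where "m = max 0 (ln (a ^ 8) - ln (s + shift a))"
  define r where "r = s + shift a"
  have pos: "r > 0"
    using shift_pos assms by (simp add: r_def)
  have "((\<lambda>s. 1 - cos (max 0 (ln (a ^ 8) - ln (s + shift a)))) has_real_derivative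
      sin m * (- 1 / r)) (at s)"
    unfolding m_def using pos unfolding r_def by (intro DERIV_chain2[OF cutoff_DERIV2]) (auto intro!: derivative_eq_intros)
  from DERIV_divide[OF DERIV_cmult[OF this, of "- a"], of "\<lambda>s. s + shift a" 1] show ?thesis
    unfolding profile1_def [abs_def] profile2_def
    unfolding r_def[symmetric] m_def[symmetric]
    by (rule DERIV_cong)
      (use pos in \<open>auto intro!: derivative_eq_intros simp: m_def r_def[symmetric] power2_eq_square field_simps\<close>)
qed

lemma continuous_on_profile2: "continuous_on {0..} (profile2 a)"
proof -
  have "s + shift a \<noteq> 0" if "s \<ge> 0" for s
    using shift_pos that by simp
  then show ?thesis
    unfolding profile2_def by (intro continuous_intros) auto
qed

lemma profile_eq_0:
  assumes "s \<ge> a ^ 8"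
  shows "profile a s = 0" "profile1 a s = 0" "profile2 a s = 0"
proof -
  have "0 < a ^ 8" using a by simp
  then have "ln (a ^ 8) \<le> ln (s + shift a)"
    using shift_pos assms by (subst ln_le_cancel_iff) linarith+
  then show "profile a s = 0" "profile1 a s = 0" "profile2 a s = 0"
    by (simp_all add: profile_def profile1_def profile2_def cutoff_def)
qed

text \<open>This value becomes the mixed second derivative at the centre of the bump; it blows up as
  \<open>a\<close> tends to 0.\<close>

lemma profile_0_ge: "profile a 0 \<ge> 1 / a - a"
proof -
  have "a * (1 / a\<^sup>2 - 1) \<le> a * cutoff (1 / a\<^sup>2)"
    using cutoff_bounds(2)[of "1 / a\<^sup>2"] a by (intro mult_left_mono) auto
  moreover have "a * (1 / a\<^sup>2 - 1) = 1 / a - a"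
    using a by (simp add: field_simps power2_eq_square)
  ultimately show ?thesis
    by (simp add: profile_def ln_shift)
qed

text \<open>The argument of \<open>cutoff\<close> decreases in \<open>s\<close>, so it is at most
  its value 1 / a^2 at \<open>s = 0\<close>.\<close>

lemma abs_profile_le:
  assumes "s \<ge> 0" shows "\<bar>profile a s\<bar> \<le> 1 / a + a"
proof -
  have "ln (shift a) \<le> ln (s + shift a)"
    using shift_pos assms by (subst ln_le_cancel_iff) linarith+
  then have "max 0 (ln (a ^ 8) - ln (s + shift a)) \<le> 1 / a\<^sup>2"
    by (simp add: ln_shift)
  then have "a * cutoff (ln (a ^ 8) - ln (s + shift a)) \<le> a * (1 / a\<^sup>2 + 1)"
    using cutoff_bounds(3)[of "ln (a ^ 8) - ln (s + shift a)"] a by (intro mult_left_mono) linarith+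
  moreover have "a * (1 / a\<^sup>2 + 1) = 1 / a + a"
    using a by (simp add: field_simps power2_eq_square)
  ultimately show ?thesis
    using a cutoff_bounds(1) by (simp add: profile_def)
qed

text \<open>The quotient s / (s + shift a) is at most 1 and 1 - cos is at most 2. The bound is
  linear in \<open>a\<close> and uniform in \<open>s\<close>, unlike the one on the profile itself;
  together with its analogue for \<open>profile2\<close> it makes the Laplacian small.\<close>

lemma abs_profile1_le:
  assumes "s \<ge> 0" shows "s * \<bar>profile1 a s\<bar> \<le> 2 * a"
proof -
  define m where "m = max 0 (ln (a ^ 8) - ln (s + shift a))"
  have "s * \<bar>profile1 a s\<bar> = a * (1 - cos m) * (s / (s + shift a))"
    using a shift_pos assms by (simp add: profile1_def abs_mult m_def)
  also have "\<dots> \<le> (a * 2) * 1"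
    using a shift_pos assms cos_ge_minus_one[of m] by (intro mult_mono) auto
  finally show ?thesis by simp
qed

lemma abs_profile2_le:
  assumes "s \<ge> 0" shows "s\<^sup>2 * \<bar>profile2 a s\<bar> \<le> 3 * a"
proof -
  define m where "m = max 0 (ln (a ^ 8) - ln (s + shift a))"
  have m: "\<bar>sin m + (1 - cos m)\<bar> \<le> 3"
    using cos_ge_minus_one[of m] sin_le_one[of m] sin_ge_minus_one[of m] cos_le_one[of m] by linarith
  have "s\<^sup>2 * \<bar>profile2 a s\<bar> = a * \<bar>sin m + (1 - cos m)\<bar> * (s / (s + shift a))\<^sup>2"
    using a by (simp add: profile2_def abs_mult m_def power_divide)
  also have "\<dots> \<le> (a * 3) * 1\<^sup>2"
    using a shift_pos assms m
    by (intro mult_mono power_mono) auto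
  finally show ?thesis by simp
qed

end

section \<open>Gluing functions supported in disjoint annuli\<close>

lemma zero_function:
  "partial_deriv l (\<lambda>_ :: real ^ 'n. 0) = (\<lambda>_. 0)" "laplacian (\<lambda>_ :: real ^ 'n. 0) = (\<lambda>_. 0)"
  "twice_differentiable_at (\<lambda>_ :: real ^ 'n. 0) x"
proof -
  show "partial_deriv l (\<lambda>_ :: real ^ 'n. 0) = (\<lambda>_. 0)" for l
    by (simp add: partial_deriv_def fun_eq_iff)
  then show "laplacian (\<lambda>_ :: real ^ 'n. 0) = (\<lambda>_. 0)"
    "twice_differentiable_at (\<lambda>_ :: real ^ 'n. 0) x"
    by (auto simp: laplacian_def twice_differentiable_at_def)
qed

text \<open>The annuli have central radii 1/2, 1/4, ... and are disjoint, as (9/8)(1/2) < 7/8. The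
  constant \<open>C\<close> does not depend on \<open>k\<close>, so the estimates pass to the
  sum.\<close>

locale annular_family =
  fixes w :: "nat \<Rightarrow> real ^ 'n::finite \<Rightarrow> real" and C :: real
  assumes supp: "\<And>k x. w k x \<noteq> 0 \<Longrightarrow>
      7 / 8 * (1 / 2) ^ Suc k \<le> norm x \<and> norm x \<le> 9 / 8 * (1 / 2) ^ Suc k"
    and C: "C \<ge> 0"
    and td: "\<And>k x. twice_differentiable_at (w k) x"
    and w_le: "\<And>k x. \<bar>w k x\<bar> \<le> C * (norm x)\<^sup>2"
    and partial_le: "\<And>k l x. \<bar>partial_deriv l (w k) x\<bar> \<le> C * (norm x)\<^sup>2"
    and laplacian_le: "\<And>k x. \<bar>laplacian (w k) x\<bar> \<le> C * norm x"
    and laplacian_cont: "\<And>k. continuous_on UNIV (laplacian (w k))"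
begin

definition glued :: "real ^ 'n \<Rightarrow> real" where
  "glued x = (\<Sum>k. w k x)"

text \<open>With r = (1/2)^(k+1), the bounds are the outer radius 9r/16 of the next smaller annulus
  and the inner radius 7r/4 of the next larger one. Consecutive shells of this kind overlap, so they
  leave no gaps.\<close>

lemma glued_eq:
  assumes "9 / 16 * (1 / 2) ^ Suc k < norm x" "norm x < 7 / 4 * (1 / 2) ^ Suc k"
  shows "glued x = w k x"
proof -
  have "w l x = 0" if "l \<noteq> k" for l
  proof (rule ccontr)
    assume "w l x \<noteq> 0"
    note b = supp[OF this]
    show False
    proof (cases "l < k")
      case True
      then have "(1 / 2 :: real) ^ k \<le> (1 / 2) ^ Suc l"
        by (intro power_decreasing) auto
      then show False using b assms by simp
    next
      case False
      then have "(1 / 2 :: real) ^ l \<le> (1 / 2) ^ Suc k"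
        using that by (intro power_decreasing) auto
      then show False using b assms by simp
    qed
  qed
  then show ?thesis
    unfolding glued_def by (subst suminf_finite[of "{k}"]) auto
qed

lemma glued_eq_0:
  assumes "x = 0 \<or> norm x > 9 / 16"
  shows "glued x = 0"
proof -
  have "w k x = 0" for k
  proof (rule ccontr)
    assume "w k x \<noteq> 0"
    note b = supp[OF this]
    have "(1 / 2 :: real) ^ k \<le> (1 / 2) ^ 0" "(0::real) < (1 / 2) ^ k"
      by (intro power_decreasing) auto
    then show False using b assms unfolding power_Suc by (auto simp: not_le[symmetric])
  qed
  then show ?thesis by (simp add: glued_def)
qed

lemma eventually_glued_eq:
  assumes "9 / 16 * (1 / 2) ^ Suc k < norm x" "norm x < 7 / 4 * (1 / 2) ^ Suc k"
  shows "\<forall>\<^sub>F y in nhds x. glued y = w k y"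
proof -
  have "open {y. 9 / 16 * (1 / 2) ^ Suc k < norm y \<and> norm y < 7 / 4 * (1 / 2) ^ Suc k}"
    by (intro open_Collect_conj open_Collect_less continuous_intros)
  from eventually_nhds_in_open[OF this, of x] show ?thesis
    using assms by (auto elim!: eventually_mono intro: glued_eq)
qed

text \<open>Every nonzero point lies either beyond 9/16, the outer radius of the largest annulus, or
  in one of the open shells of \<open>glued_eq\<close>. Local properties of the sum thus reduce to
  those of one member or of 0.\<close>

lemma eventually_glued_eq_member:
  assumes "x \<noteq> 0"
  obtains v where "v = (\<lambda>_. 0) \<or> v \<in> range w" "\<forall>\<^sub>F y in nhds x. glued y = v y"
proof (cases "norm x > 9 / 16")
  case True
  have "open {y :: real ^ 'n. norm y > 9 / 16}"
    by (intro open_Collect_less continuous_intros)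
  from eventually_nhds_in_open[OF this, of x] have "\<forall>\<^sub>F y in nhds x. glued y = 0"
    using True by (auto elim!: eventually_mono intro: glued_eq_0)
  then show ?thesis using that by blast
next
  case False
  have "\<exists>k. 9 / 16 * (1 / 2) ^ Suc k < norm x"
  proof -
    obtain k where "(1 / 2) ^ k < norm x"
      using real_arch_pow_inv[of "norm x" "1 / 2"] assms by auto
    then have "9 / 16 * (1 / 2) ^ Suc k < norm x"
      using zero_less_power[of "1 / 2 :: real" k] unfolding power_Suc by linarith
    then show ?thesis ..
  qed
  \<comment> \<open>Minimality gives norm x \<le> (9/16)(1/2)^k when k > 0, and this is below the
    upper radius (7/8)(1/2)^k of shell \<open>k\<close>. For \<open>k = 0\<close> the assumption
    norm x \<le> 9/16 does the same.\<close>
  define k where "k = (LEAST k. 9 / 16 * (1 / 2) ^ Suc k < norm x)"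
  have 1: "9 / 16 * (1 / 2) ^ Suc k < norm x"
    unfolding k_def by (rule LeastI_ex) fact
  have 2: "norm x < 7 / 4 * (1 / 2) ^ Suc k"
  proof (cases k)
    case 0
    then show ?thesis using False by simp
  next
    case (Suc m)
    then have "\<not> 9 / 16 * (1 / 2) ^ Suc m < norm x"
      using not_less_Least[of m "\<lambda>k. 9 / 16 * (1 / 2) ^ Suc k < norm x"] by (simp add: k_def)
    moreover have "(0::real) < (1 / 2) ^ Suc m" by simp
    ultimately show ?thesis
      unfolding Suc power_Suc[of _ "Suc m"] by linarith
  qed
  show ?thesis
    using that eventually_glued_eq[OF 1 2] by blast
qed

lemma compact_support_glued: "compact_support glued"
proof -
  have "{x. glued x \<noteq> 0} \<subseteq> cball 0 (9 / 16)"
    using glued_eq_0 by (auto simp: not_less[symmetric])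
  then have "bounded {x. glued x \<noteq> 0}"
    using bounded_cball bounded_subset by blast
  then show ?thesis
    by (simp add: compact_support_def compact_closure)
qed

lemma glued_away:
  assumes "x \<noteq> 0"
  shows "twice_differentiable_at glued x" "\<bar>glued x\<bar> \<le> C * (norm x)\<^sup>2"
    "\<bar>partial_deriv l glued x\<bar> \<le> C * (norm x)\<^sup>2" "\<bar>laplacian glued x\<bar> \<le> C * norm x"
    "isCont (laplacian glued) x"
proof -
  obtain v where v: "v = (\<lambda>_. 0) \<or> v \<in> range w" and ev: "\<forall>\<^sub>F y in nhds x. glued y = v y"
    by (rule eventually_glued_eq_member[OF assms])
  show "twice_differentiable_at glued x"
    by (rule twice_differentiable_at_cong_ev[OF ev]) (use v td zero_function(3) in blast)
  show "\<bar>glued x\<bar> \<le> C * (norm x)\<^sup>2"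
    using eventually_nhds_x_imp_x[OF ev] v w_le C by auto
  show "\<bar>partial_deriv l glued x\<bar> \<le> C * (norm x)\<^sup>2"
    unfolding partial_deriv_cong_ev[OF ev] using v partial_le C by (auto simp: zero_function)
  show "\<bar>laplacian glued x\<bar> \<le> C * norm x"
    unfolding laplacian_cong_ev[OF ev] using v laplacian_le C by (auto simp: zero_function)
  have "\<forall>\<^sub>F y in nhds x. \<forall>\<^sub>F z in nhds y. glued z = v z"
    using ev by (simp add: eventually_eventually)
  then have "\<forall>\<^sub>F y in nhds x. laplacian glued y = laplacian v y"
    by eventually_elim (rule laplacian_cong_ev)
  moreover have "isCont (laplacian v) x"
    using v laplacian_cont by (auto simp: zero_function continuous_on_eq_continuous_at)
  ultimately show "isCont (laplacian glued) x"
    by (simp add: isCont_cong)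
qed

lemma twice_differentiable_at_glued: "twice_differentiable_at glued x"
  and laplacian_glued_0: "laplacian glued 0 = 0"
proof -
  have u: "\<bar>glued x\<bar> \<le> C * (norm x)\<^sup>2" for x
    using glued_away(2) glued_eq_0 by (cases "x = 0") auto
  note * = twice_differentiable_at_zero[OF u glued_away(3) glued_away(1)]
  show "twice_differentiable_at glued x"
    using *(1) glued_away(1) by (cases "x = 0") auto
  show "laplacian glued 0 = 0"
    by (rule *(2))
qed

lemma continuous_laplacian_glued: "continuous_on UNIV (laplacian glued)"
proof (intro continuous_at_imp_continuous_on ballI)
  fix x :: "real ^ 'n"
  \<comment> \<open>Continuity at the origin comes from the linear bound away from it and the value
    0 there.\<close>
  have "isCont (laplacian glued) 0"
    unfolding isCont_def laplacian_glued_0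
  proof (rule Lim_null_comparison)
    show "\<forall>\<^sub>F x in at 0. norm (laplacian glued x) \<le> C * norm x"
      using glued_away(4) by (auto simp: eventually_at_filter)
    show "((\<lambda>x. C * norm x) \<longlongrightarrow> 0) (at (0 :: real ^ 'n))"
      by (auto intro!: tendsto_eq_intros)
  qed
  then show "isCont (laplacian glued) x"
    using glued_away(5) by (cases "x = 0") auto
qed

end

section \<open>Uniform estimates for one bump at distance \<open>a\<close> from the origin\<close>

lemma
  fixes p :: "real ^ 'n::finite"
  assumes a: "0 < a" "a \<le> 1 / 2" and p: "norm p = a" and ij: "i \<noteq> j"
  defines "w \<equiv> bump i j p (profile a)"
  shows radial_profile_bump: "radial_profile i j (profile a) (profile1 a) (profile2 a)"
    and bump_support: "w x \<noteq> 0 \<Longrightarrow> 7 / 8 * a \<le> norm x \<and> norm x \<le> 9 / 8 * a"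
    and bump_le: "\<bar>w x\<bar> \<le> 16 * (norm x)\<^sup>2"
    and partial_bump_le: "\<bar>partial_deriv l w x\<bar> \<le> 16 * (norm x)\<^sup>2"
    and laplacian_bump_le: "\<bar>laplacian w x\<bar> \<le> (8 * real CARD('n) + 56) * norm x"
proof -
  show rp: "radial_profile i j (profile a) (profile1 a) (profile2 a)"
    using a ij by unfold_locales (auto intro: profile_DERIV profile1_DERIV continuous_on_profile2)
  then interpret radial_profile i j p "profile a" "profile1 a" "profile2 a" .
  define z where "z = x - p"
  define s where "s = z \<bullet> z"
  define F where "F = profile a s"
  define F1 where "F1 = profile1 a s"
  define F2 where "F2 = profile2 a s"
  have s_norm: "s = (norm z)\<^sup>2" and s0: "s \<ge> 0"
    by (simp_all add: s_def power2_norm_eq_inner)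
  have w: "w x = z $ i * z $ j * F"
    by (simp add: w_def bump_def z_def s_def F_def)
  have pw: "partial_deriv l w x = of_bool (l = i) * z $ j * F + of_bool (l = j) * z $ i * F
      + 2 * z $ i * z $ j * z $ l * F1"
    by (simp add: w_def partial_deriv_bump z_def s_def F_def F1_def)
  have lw: "laplacian w x = z $ i * z $ j * (4 * s * F2 + (2 * real CARD('n) + 8) * F1)"
    by (simp add: w_def laplacian_bump z_def s_def F1_def F2_def)
  \<comment> \<open>The profile is evaluated at the squared distance, so vanishing for
    \<open>s \<ge> a ^ 8\<close> means that the bump lives in norm z < a^4.\<close>
  have "a ^ 8 = (a ^ 4)\<^sup>2"
    by simp
  then have far: "F = 0 \<and> F1 = 0 \<and> F2 = 0" if "norm z \<ge> a ^ 4"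
    using that a power_mono[OF that, of 2]
    by (auto simp: F_def F1_def F2_def s_norm intro!: profile_eq_0)
  have a2: "a\<^sup>2 \<le> 1 / 4"
    using a power_mono[of a "1 / 2" 2] by (simp add: power2_eq_square)
  have a4: "a ^ 4 \<le> a / 8"
    using mult_left_mono[OF power_mono[of a "1 / 2" 3], of a] a by (simp add: power_numeral_reduce)
  have near: "7 / 8 * a \<le> norm x \<and> norm x \<le> 9 / 8 * a" if "norm z < a ^ 4"
    using that a4 p norm_triangle_ineq[of z p] norm_triangle_ineq3[of x p] by (auto simp: z_def)
  show "w x \<noteq> 0 \<Longrightarrow> 7 / 8 * a \<le> norm x \<and> norm x \<le> 9 / 8 * a"
    using far near by (force simp: w not_less)
  have z_le: "\<bar>z $ l\<bar> \<le> norm z" for l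
    by (rule component_le_norm_cart)
  have F1: "s * \<bar>F1\<bar> \<le> 2 * a" and F2: "s\<^sup>2 * \<bar>F2\<bar> \<le> 3 * a"
    using abs_profile1_le[OF a(1) s0] abs_profile2_le[OF a(1) s0] by (simp_all add: F1_def F2_def)
  have zij: "\<bar>z $ i * z $ j\<bar> \<le> s"
    using mult_mono[OF z_le[of i] z_le[of j]] by (simp add: abs_mult s_norm power2_eq_square)
  \<comment> \<open>The radius a^4 outweighs the height 1/a + a of the profile: the product is a^3 +
    a^5, at most (5/8) a^2 for a \<le> 1/2.\<close>
  have zF: "norm z * \<bar>F\<bar> \<le> a\<^sup>2"
  proof (cases "norm z < a ^ 4")
    case True
    have "norm z * \<bar>F\<bar> \<le> a ^ 4 * (1 / a + a)"
      using True abs_profile_le[OF a(1) s0] by (intro mult_mono) (auto simp: F_def)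
    also have "\<dots> = a\<^sup>2 * (a + a * a\<^sup>2)"
      using a by (simp add: field_simps power_numeral_reduce)
    also have "\<dots> \<le> a\<^sup>2 * (1 / 2 + (1 / 2) * (1 / 4))"
      using a a2 by (intro mult_left_mono add_mono mult_mono) auto
    also have "\<dots> \<le> a\<^sup>2"
      by simp
    finally show ?thesis .
  qed (use far in auto)
  have zF1: "norm z * (s * \<bar>F1\<bar>) \<le> a\<^sup>2"
  proof (cases "norm z < a ^ 4")
    case True
    have "norm z * (s * \<bar>F1\<bar>) \<le> a / 8 * (2 * a)"
      by (rule mult_mono) (use True a4 a F1 s0 in auto)
    then show ?thesis
      using zero_le_power2[of a] unfolding power2_eq_square by linarith
  qed (use far in auto)
  \<comment> \<open>On the support, norm x is comparable to \<open>a\<close>; this converts bounds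
    by powers of \<open>a\<close> into bounds by powers of norm x.\<close>
  have a_le: "a\<^sup>2 \<le> 4 * (norm x)\<^sup>2 \<and> a \<le> 2 * norm x" if "norm z < a ^ 4"
  proof -
    have "a \<le> 2 * norm x"
      using near[OF that] a by linarith
    then show ?thesis
      using power_mono[of a "2 * norm x" 2] a by (simp add: power_mult_distrib)
  qed
  show "\<bar>w x\<bar> \<le> 16 * (norm x)\<^sup>2"
  proof (cases "norm z < a ^ 4")
    case True
    have "\<bar>w x\<bar> \<le> norm z * (norm z * \<bar>F\<bar>)"
      using mult_right_mono[OF zij abs_ge_zero[of F]] by (simp add: w abs_mult s_norm power2_eq_square mult_ac)
    also have "\<dots> \<le> 1 * a\<^sup>2"
      using True a a4 zF by (intro mult_mono) auto
    finally show ?thesis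
      using a_le[OF True] zero_le_power2[of "norm x"] by linarith
  qed (use far w in auto)
  show "\<bar>partial_deriv l w x\<bar> \<le> 16 * (norm x)\<^sup>2"
  proof (cases "norm z < a ^ 4")
    case True
    have 1: "\<bar>of_bool b * z $ k * F\<bar> \<le> a\<^sup>2" for b k
      using order_trans[OF mult_right_mono[OF z_le[of k] abs_ge_zero[of F]] zF] by (auto simp: abs_mult)
    have "\<bar>z $ i * z $ j\<bar> * \<bar>z $ l\<bar> * \<bar>F1\<bar> \<le> s * norm z * \<bar>F1\<bar>"
      using zij z_le s0 by (intro mult_mono) auto
    then have "\<bar>2 * z $ i * z $ j * z $ l * F1\<bar> \<le> 2 * a\<^sup>2"
      using zF1 by (simp add: abs_mult mult_ac)
    \<comment> \<open>Each of the two terms with \<open>F\<close> costs a^2 and the term with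
      \<open>F1\<close> costs 2 a^2. Together with a^2 \<le> 4 (norm x)^2 this yields the constant
      16.\<close>
    then have "\<bar>partial_deriv l w x\<bar> \<le> 4 * a\<^sup>2"
      unfolding pw using 1[of "l = i" j] 1[of "l = j" i] by linarith
    then show ?thesis
      using a_le[OF True] by linarith
  qed (use far pw in auto)
  show "\<bar>laplacian w x\<bar> \<le> (8 * real CARD('n) + 56) * norm x"
  proof (cases "norm z < a ^ 4")
    case True
    have "\<bar>laplacian w x\<bar> \<le> s * \<bar>4 * s * F2 + (2 * real CARD('n) + 8) * F1\<bar>"
      unfolding lw abs_mult[of "z $ i * z $ j"] by (rule mult_right_mono[OF zij]) simp
    also have "\<dots> \<le> s * (4 * s * \<bar>F2\<bar> + (2 * real CARD('n) + 8) * \<bar>F1\<bar>)"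
      using s0 by (intro mult_left_mono order_trans[OF abs_triangle_ineq]) (auto simp: abs_mult)
    also have "\<dots> = 4 * (s\<^sup>2 * \<bar>F2\<bar>) + (2 * real CARD('n) + 8) * (s * \<bar>F1\<bar>)"
      by (simp add: algebra_simps power2_eq_square)
    also have "\<dots> \<le> 4 * (3 * a) + (2 * real CARD('n) + 8) * (2 * a)"
      using F1 F2 by (intro add_mono mult_left_mono) auto
    also have "\<dots> = (4 * real CARD('n) + 28) * a"
      by (simp add: algebra_simps)
    also have "\<dots> \<le> (4 * real CARD('n) + 28) * (2 * norm x)"
      using a_le[OF True] by (intro mult_left_mono) auto
    finally show ?thesis
      by (simp add: algebra_simps)
  qed (use far lw in auto)
qed

section \<open>Assembling the function from the bumps\<close>

theorem theorem1p1:
  fixes \<phi> :: "real \<Rightarrow> real"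
  assumes "CARD('n::finite) \<ge> 2"
    and "C2_pos \<phi>"
    and "filterlim \<phi> at_top at_top"
    and "(deriv \<phi> \<longlongrightarrow> 0) at_top"
    and "(deriv (deriv \<phi>) \<longlongrightarrow> 0) at_top"
  shows "\<exists>u :: real ^ 'n \<Rightarrow> real.
           compact_support u \<and>
           (\<forall>x. twice_differentiable_at u x) \<and>
           continuous_on UNIV (laplacian u) \<and>
           unbounded_hessian u \<and>
           \<not> C2_euclidean u"
proof -
  obtain i j :: 'n where ij: "i \<noteq> j"
    using assms(1) card_le_Suc0_iff_eq[of "UNIV :: 'n set"] by fastforce
  define a :: "nat \<Rightarrow> real" where "a k = (1 / 2) ^ Suc k" for k
  define p :: "nat \<Rightarrow> real ^ 'n" where "p k = a k *\<^sub>R axis i 1" for k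
  define w where "w k = bump i j (p k) (profile (a k))" for k
  have a: "0 < a k" "a k \<le> 1 / 2" for k
    using power_decreasing[of 0 k "1 / 2 :: real"] by (auto simp: a_def)
  have p: "norm (p k) = a k" for k
    using a[of k] by (simp add: p_def)
  note bump = radial_profile_bump[OF a p ij] bump_support[OF a p ij] bump_le[OF a p ij]
    partial_bump_le[OF a p ij] laplacian_bump_le[OF a p ij]
  define C where "C = 8 * real CARD('n) + 56"
  have C16: "16 * (norm x)\<^sup>2 \<le> C * (norm x)\<^sup>2" for x :: "real ^ 'n"
    by (intro mult_right_mono) (auto simp: C_def)
  interpret annular_family w C
  proof
    show "7 / 8 * (1 / 2) ^ Suc k \<le> norm x \<and> norm x \<le> 9 / 8 * (1 / 2) ^ Suc k" if "w k x \<noteq> 0" for k x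
      using bump(2)[of k x] that by (simp only: w_def a_def) simp
    show "0 \<le> C" by (simp add: C_def)
    show "twice_differentiable_at (w k) x" "continuous_on UNIV (laplacian (w k))" for k x
      unfolding w_def using bump(1)
      by (auto intro: radial_profile.twice_differentiable_at_bump radial_profile.continuous_laplacian_bump)
    show "\<bar>w k x\<bar> \<le> C * (norm x)\<^sup>2" "\<bar>partial_deriv l (w k) x\<bar> \<le> C * (norm x)\<^sup>2"
      "\<bar>laplacian (w k) x\<bar> \<le> C * norm x" for k l x
      using bump(3)[of k x] bump(4)[of l k x] bump(5)[of k x] C16[of x] by (auto simp: w_def C_def)
  qed
  have mixed: "hessian glued (p k) $ i $ j = profile (a k) 0" for k
  proof -
    \<comment> \<open>The centre has norm exactly \<open>a k\<close>, strictly inside the shell from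
      (9/16) \<open>a k\<close> to (7/4) \<open>a k\<close>.\<close>
    have "\<forall>\<^sub>F y in nhds (p k). glued y = w k y"
      using a[of k] p[of k] by (intro eventually_glued_eq) (simp_all only: a_def)
    then show ?thesis
      using radial_profile.mixed_partial_bump_center[OF bump(1)]
      by (simp add: hessian_def w_def second_partial_cong_ev)
  qed
  have "\<not> bounded (range (\<lambda>x. hessian glued x $ i $ j))"
  proof
    assume "bounded (range (\<lambda>x. hessian glued x $ i $ j))"
    then obtain B where B: "\<And>x. \<bar>hessian glued x $ i $ j\<bar> \<le> B"
      by (auto simp: bounded_iff)
    \<comment> \<open>The extra 1 absorbs the loss \<open>a k \<le> 1 / 2\<close> in the lower bound
      1 / a - a for the mixed derivative.\<close>
    obtain k where k: "B + 1 < 2 ^ k"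
      using real_arch_pow[of 2 "B + 1"] by auto
    have "2 ^ k \<le> 1 / a k"
      by (simp add: a_def power_divide)
    then have "profile (a k) 0 > B"
      using profile_0_ge[OF a(1)[of k]] a(2)[of k] k by linarith
    then show False
      using B[of "p k"] by (simp add: mixed)
  qed
  then have "unbounded_hessian glued"
    unfolding unbounded_hessian_def by blast
  then show ?thesis
    using compact_support_glued twice_differentiable_at_glued continuous_laplacian_glued
      hessian_unbounded_imp_not_C2 by blast
qed

end
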